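(* Let $f:\mathbb{R}^d\to\mathbb{R}$ be $\mu$-strongly-convex ($\mu>0$) and $L$-smooth, let $s>0$, and let $(X(t),V(t))_{t\ge0}$ be a solution of the ODE $\dot X=-m\nabla f(X)-nV$, $\dot V=\nabla f(X)-qV$. (1) Suppose $$0<m\sqrt s-\frac{ns}{1-q\sqrt s}\le\frac1{2L},\qquad 0<ns\le\frac{1-q\sqrt s}{2}m\sqrt s,\qquad 0<q\sqrt s\le\frac12,$$ and let $(x_k^{\mathrm{EE}})$ be the position iterates of the explicit Euler discretization of this ODE with step-size $\sqrt s$. Then, as $k\to\infty$, $$\|X(k\sqrt s)-x_k^{\mathrm{EE}}\|=O\big((1+\gamma_3\sqrt s)^{-k}\big),\qquad \gamma_3:=\frac15\min\left(\frac{n\mu}{q(1-q\sqrt s)},\ \frac{q}{1+q^2/(nL)}\right).$$ (2) Suppose $$0<m\sqrt s\le\frac1{2L},\qquad 0<ns\le m\sqrt s,\qquad 0<q\sqrt s\le\frac12,$$ and let $(x_k^{\mathrm{SIE}})$ be the position iterates of the semi-implicit Euler discretization of this ODE with step-size $\sqrt s$. Then, as $k\to\infty$, $$\|X(k\sqrt s)-x_{k+1}^{\mathrm{SIE}}\|=O\big((1+\gamma_2\sqrt s)^{-k}\big),\qquad \gamma_2:=\frac15\min\left(\frac{n\mu}{q},\ \frac{q}{1+q^2/(nL)}\right).$$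
   Context: $\|\cdot\|$ is the Euclidean norm. $f$ is $L$-smooth if it is differentiable and $\|\nabla f(x)-\nabla f(y)\|\le L\|x-y\|$ for all $x,y$; $f$ is $\mu$-strongly-convex if $f(y)\ge f(x)+\langle\nabla f(x),y-x\rangle+\frac\mu2\|y-x\|^2$ for all $x,y$. Explicit Euler: $x_{k+1}-x_k=-m\sqrt s\nabla f(x_k)-n\sqrt s\,v_k$, $v_{k+1}-v_k=\sqrt s\nabla f(x_k)-q\sqrt s\,v_k$. Semi-implicit Euler: $x_{k+1}-x_k=-m\sqrt s\nabla f(x_k)-n\sqrt s\,v_k$, $v_{k+1}-v_k=\sqrt s\nabla f(x_{k+1})-q\sqrt s\,v_k$. The $O(\cdot)$ is in $k$, with $f$, $m,n,q,s$ and the initial data fixed; the implied constant does not depend on $k$. *)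

theory Defs
  imports "HOL-Analysis.Analysis" "HOL-Library.Landau_Symbols"
begin

(* Meaningful only where f is differentiable; there it is the unique gradient (see GDERIV_grad). *)
definition grad :: "('a::euclidean_space \<Rightarrow> real) \<Rightarrow> 'a \<Rightarrow> 'a" where
  "grad f x = (THE D. GDERIV f x :> D)"

lemma GDERIV_grad:
  fixes f :: "'a::euclidean_space \<Rightarrow> real"
  assumes "f differentiable (at x)"
  shows "GDERIV f x :> grad f x"
proof -
  obtain f' where f': "(f has_derivative f') (at x)"
    using assms unfolding differentiable_def ..
  then have lin: "linear f'"
    by (rule has_derivative_linear)
  define D where "D = (\<Sum>i\<in>Basis. f' i *\<^sub>R i)"
  have "f' h = inner h D" for h
  proof -
    have "f' h = f' (\<Sum>i\<in>Basis. inner h i *\<^sub>R i)"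
      by (simp add: euclidean_representation)
    also have "\<dots> = (\<Sum>i\<in>Basis. inner h i * f' i)"
      using lin by (simp add: linear_sum linear_scale)
    also have "\<dots> = inner h D"
      by (simp add: D_def inner_sum_right mult.commute)
    finally show ?thesis .
  qed
  then have "f' = (\<lambda>h. inner h D)"
    by (rule ext)
  then have D: "GDERIV f x :> D"
    using f' by (simp add: gderiv_def)
  have uniq: "D' = D" if "GDERIV f x :> D'" for D'
  proof -
    have eq: "(\<lambda>h. inner h D') = (\<lambda>h. inner h D)"
      using that D unfolding gderiv_def by (rule has_derivative_unique)
    have "inner (D' - D) D' = inner (D' - D) D"
      using fun_cong[OF eq, of "D' - D"] .
    then have "inner (D' - D) (D' - D) = 0"
      by (simp add: inner_diff_right)
    then show ?thesis
      by simp
  qed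
  show ?thesis
    unfolding grad_def using D uniq by (rule theI)
qed

definition L_smooth :: "real \<Rightarrow> ('a::euclidean_space \<Rightarrow> real) \<Rightarrow> bool" where
  "L_smooth L f \<longleftrightarrow>
     (\<forall>x. f differentiable (at x)) \<and>
     (\<forall>x y. norm (grad f x - grad f y) \<le> L * norm (x - y))"

definition strongly_convex :: "real \<Rightarrow> ('a::euclidean_space \<Rightarrow> real) \<Rightarrow> bool" where
  "strongly_convex \<mu> f \<longleftrightarrow>
     (\<forall>x. f differentiable (at x)) \<and>
     (\<forall>x y. f y \<ge> f x + inner (grad f x) (y - x) + \<mu> / 2 * (norm (y - x))\<^sup>2)"

(* Derivatives are taken within {0..}, hence one-sided at t = 0. *)
definition ode_solution ::
  "real \<Rightarrow> real \<Rightarrow> real \<Rightarrow> ('a::euclidean_space \<Rightarrow> real) \<Rightarrow> (real \<Rightarrow> 'a) \<Rightarrow> (real \<Rightarrow> 'a) \<Rightarrow> bool" where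
  "ode_solution m n q f X V \<longleftrightarrow>
     (\<forall>t\<ge>0.
       (X has_vector_derivative (- m *\<^sub>R grad f (X t) - n *\<^sub>R V t)) (at t within {0..}) \<and>
       (V has_vector_derivative (grad f (X t) - q *\<^sub>R V t)) (at t within {0..}))"

(* In both schemes the step size is sqrt s and the initial pair (x 0, v 0) is arbitrary. *)
definition explicit_euler ::
  "real \<Rightarrow> real \<Rightarrow> real \<Rightarrow> real \<Rightarrow> ('a::euclidean_space \<Rightarrow> real) \<Rightarrow> (nat \<Rightarrow> 'a) \<Rightarrow> (nat \<Rightarrow> 'a) \<Rightarrow> bool" where
  "explicit_euler m n q s f x v \<longleftrightarrow>
     (\<forall>k. x (Suc k) - x k = - (m * sqrt s) *\<^sub>R grad f (x k) - (n * sqrt s) *\<^sub>R v k \<and>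
          v (Suc k) - v k = sqrt s *\<^sub>R grad f (x k) - (q * sqrt s) *\<^sub>R v k)"

definition semi_implicit_euler ::
  "real \<Rightarrow> real \<Rightarrow> real \<Rightarrow> real \<Rightarrow> ('a::euclidean_space \<Rightarrow> real) \<Rightarrow> (nat \<Rightarrow> 'a) \<Rightarrow> (nat \<Rightarrow> 'a) \<Rightarrow> bool" where
  "semi_implicit_euler m n q s f x v \<longleftrightarrow>
     (\<forall>k. x (Suc k) - x k = - (m * sqrt s) *\<^sub>R grad f (x k) - (n * sqrt s) *\<^sub>R v k \<and>
          v (Suc k) - v k = sqrt s *\<^sub>R grad f (x (Suc k)) - (q * sqrt s) *\<^sub>R v k)"

definition gamma3 :: "real \<Rightarrow> real \<Rightarrow> real \<Rightarrow> real \<Rightarrow> real \<Rightarrow> real" where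
  "gamma3 \<mu> L n q s =
     1 / 5 * min (n * \<mu> / (q * (1 - q * sqrt s))) (q / (1 + q\<^sup>2 / (n * L)))"

definition gamma2 :: "real \<Rightarrow> real \<Rightarrow> real \<Rightarrow> real \<Rightarrow> real" where
  "gamma2 \<mu> L n q = 1 / 5 * min (n * \<mu> / q) (q / (1 + q\<^sup>2 / (n * L)))"

end

theory Submission imports Defs begin

text \<open>The trajectory and the iterates are compared through the minimizer \<open>z\<close> of \<open>f\<close>: each
converges to \<open>z\<close> at the claimed rate \<open>\<gamma>\<close>, so the triangle inequality suffices and no estimate of
the discretization error is needed. Since \<open>f - f z\<close> is comparable to the square of the
distance to \<open>z\<close>, a Lyapunov function must contract with rate \<open>2 \<gamma>\<close>, which is where the factor
\<open>1 / 5\<close> is used. With \<open>y = X - z\<close>, the combination \<open>q y - n V\<close> has derivative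
\<open>-(n + m q) \<nabla>f(X)\<close>, and adding half its square and a kinetic term to a multiple of \<open>f - f z\<close>
gives a function whose derivative contains no cross term between \<open>\<nabla>f(X)\<close> and \<open>V\<close>. The
semi-implicit scheme has an analogous Lyapunov function, and the explicit scheme is the
semi-implicit one with shifted velocities \<open>v (k + 1)\<close> and modified parameters.\<close>

section \<open>Inequalities for smooth and strongly convex functions\<close>

text \<open>Along the segment from \<open>x\<close> to \<open>y\<close>, the difference between
  \<open>f\<close> and its quadratic model has derivative \<open>\<phi>'\<close>, which is
  nonpositive by Cauchy-Schwarz and the Lipschitz bound on the gradient.\<close>

lemma descent:
  fixes f :: "'a::euclidean_space \<Rightarrow> real"
  assumes "L_smooth L f"
  shows "f y \<le> f x + inner (grad f x) (y - x) + L / 2 * (norm (y - x))\<^sup>2"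
proof -
  define d where "d = y - x"
  define \<phi> where "\<phi> t = f (x + t *\<^sub>R d) - t * inner (grad f x) d - L / 2 * t\<^sup>2 * (norm d)\<^sup>2" for t
  define \<phi>' where "\<phi>' t = inner (grad f (x + t *\<^sub>R d) - grad f x) d - L * t * (norm d)\<^sup>2" for t
  have der: "(\<phi> has_real_derivative \<phi>' t) (at t)" for t
  proof -
    have "GDERIV f (x + t *\<^sub>R d) :> grad f (x + t *\<^sub>R d)"
      using assms by (intro GDERIV_grad) (simp add: L_smooth_def)
    then have "(f has_derivative (\<lambda>h. inner h (grad f (x + t *\<^sub>R d)))) (at (x + t *\<^sub>R d))"
      by (simp add: gderiv_def)
    moreover have "((\<lambda>t. x + t *\<^sub>R d) has_derivative (\<lambda>h. h *\<^sub>R d)) (at t)"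
      by (auto intro!: derivative_eq_intros)
    ultimately have "((\<lambda>t. f (x + t *\<^sub>R d)) has_derivative (\<lambda>h. inner (h *\<^sub>R d) (grad f (x + t *\<^sub>R d)))) (at t)"
      by (rule has_derivative_compose[rotated])
    then have "((\<lambda>t. f (x + t *\<^sub>R d)) has_real_derivative inner (grad f (x + t *\<^sub>R d)) d) (at t)"
      by (simp add: has_field_derivative_def inner_commute mult_commute_abs)
    then show ?thesis
      unfolding \<phi>_def \<phi>'_def
      by (auto intro!: derivative_eq_intros simp: inner_diff_left algebra_simps)
  qed
  have "\<phi>' t \<le> 0" if "0 \<le> t" for t
  proof -
    have "inner (grad f (x + t *\<^sub>R d) - grad f x) d \<le> norm (grad f (x + t *\<^sub>R d) - grad f x) * norm d"
      by (rule norm_cauchy_schwarz)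
    also have "norm (grad f (x + t *\<^sub>R d) - grad f x) \<le> L * norm (x + t *\<^sub>R d - x)"
      using assms unfolding L_smooth_def by blast
    then have "norm (grad f (x + t *\<^sub>R d) - grad f x) * norm d \<le> L * norm (x + t *\<^sub>R d - x) * norm d"
      by (rule mult_right_mono) simp
    also have "\<dots> = L * t * (norm d)\<^sup>2"
      using that by (simp add: power2_eq_square)
    finally show ?thesis
      by (simp add: \<phi>'_def)
  qed
  then have "\<phi> 1 \<le> \<phi> 0"
    using der by (intro DERIV_nonpos_imp_nonincreasing[of 0 1 \<phi>]) auto
  then show ?thesis
    by (simp add: \<phi>_def d_def)
qed

text \<open>The auxiliary point \<open>z\<close> is a gradient step of size \<open>1 / L\<close>
  from \<open>y\<close> for the function \<open>f\<close> minus its linear part at \<open>x\<close>,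
  whose gradient at \<open>y\<close> is \<open>e\<close>. Convexity bounds \<open>f z\<close> from
  below through \<open>x\<close>, and \<open>descent\<close> bounds it from above through
  \<open>y\<close>.\<close>

lemma strongly_convex_imp_cocoercive:
  fixes f :: "'a::euclidean_space \<Rightarrow> real"
  assumes "\<mu> \<ge> 0" "strongly_convex \<mu> f" "L_smooth L f" "L > 0"
  shows "f x + inner (grad f x) (y - x) + (norm (grad f y - grad f x))\<^sup>2 / (2 * L) \<le> f y"
proof -
  define e where "e = grad f y - grad f x"
  define z where "z = y - (1 / L) *\<^sub>R e"
  have "f x + inner (grad f x) (z - x) + \<mu> / 2 * (norm (z - x))\<^sup>2 \<le> f z"
    using assms(2) by (simp add: strongly_convex_def)
  then have "f x + inner (grad f x) (z - x) \<le> f z"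
    using assms(1) by (smt (verit) mult_nonneg_nonneg zero_le_power2 divide_nonneg_nonneg)
  also have "f z \<le> f y + inner (grad f y) (z - y) + L / 2 * (norm (z - y))\<^sup>2"
    by (rule descent) fact
  also have "L / 2 * (norm (z - y))\<^sup>2 = inner e e / (2 * L)"
    using assms(4) by (simp add: z_def dot_square_norm field_simps power2_eq_square)
  finally have "f x + inner (grad f x) (z - x) - inner (grad f y) (z - y) - inner e e / (2 * L) \<le> f y"
    by simp
  moreover have "inner (grad f x) (z - x) - inner (grad f y) (z - y)
      = inner (grad f x) (y - x) + inner e e / L"
    by (simp add: z_def e_def inner_diff_left inner_diff_right inner_commute algebra_simps add_divide_distrib diff_divide_distrib)
  ultimately show ?thesis
    using assms(4) by (simp add: power2_norm_eq_inner e_def[symmetric] field_simps)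
qed

lemma strongly_convex_stationary_point:
  fixes f :: "'a::euclidean_space \<Rightarrow> real"
  assumes "\<mu> > 0" "strongly_convex \<mu> f"
  obtains z where "grad f z = 0"
proof -
  \<comment> \<open>Outside the ball of radius \<open>R\<close> the quadratic term of the strong
    convexity bound at \<open>0\<close> outweighs the linear one, so \<open>f\<close> is at least
    \<open>f 0\<close> there and a minimizer over the ball is global.\<close>
  define R where "R = 2 * norm (grad f 0) / \<mu>"
  have diff: "f differentiable (at x)" for x
    using assms(2) by (simp add: strongly_convex_def)
  then have "continuous_on (cball 0 R) f"
    by (intro continuous_at_imp_continuous_on ballI differentiable_imp_continuous_within)
  moreover have "R \<ge> 0"
    using assms(1) by (simp add: R_def)
  ultimately obtain z where z: "z \<in> cball 0 R" and zmin: "\<And>y. y \<in> cball 0 R \<Longrightarrow> f z \<le> f y"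
    using continuous_attains_inf[of "cball 0 R" f] by auto
  have "f z \<le> f y" for y
  proof (cases "norm y \<le> R")
    case True
    then show ?thesis using zmin by simp
  next
    case False
    have "f 0 + inner (grad f 0) y + \<mu> / 2 * (norm y)\<^sup>2 \<le> f y"
      using assms(2) unfolding strongly_convex_def by (metis diff_zero)
    moreover have "- inner (grad f 0) y \<le> norm (grad f 0) * norm y"
      by (metis abs_le_iff Cauchy_Schwarz_ineq2)
    moreover have "norm (grad f 0) * norm y \<le> \<mu> / 2 * norm y * norm y"
      using False assms(1) by (intro mult_right_mono) (auto simp: R_def field_simps)
    ultimately have "f 0 \<le> f y"
      by (simp add: power2_eq_square)
    then show ?thesis
      using zmin[of 0] \<open>R \<ge> 0\<close> by simp
  qed
  moreover have der: "(f has_derivative (\<lambda>h. inner h (grad f z))) (at z)"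
    using GDERIV_grad[OF diff] by (simp add: gderiv_def)
  ultimately have "(\<lambda>h. inner h (grad f z)) = (\<lambda>h. 0)"
    by (intro differential_zero_maxmin[of z UNIV f]) auto
  then have "inner (grad f z) (grad f z) = 0"
    by metis
  then show thesis
    using that by simp
qed

section \<open>Exponential decay along the ODE\<close>

text \<open>\<open>F\<close> stands for \<open>f X - f z\<close> and \<open>y\<close> for
  \<open>X - z\<close>. In the time derivative, the product of gradient and velocity gets
  \<open>n * (n + m * q)\<close> from the shifted square, \<open>n\<^sup>2\<close> from the kinetic
  term and \<open>- n\<close> times the weight of \<open>F\<close>; the weight
  \<open>2 * n + m * q\<close> makes these cancel.\<close>

definition ode_energy :: "real \<Rightarrow> real \<Rightarrow> real \<Rightarrow> real \<Rightarrow> 'a::euclidean_space \<Rightarrow> 'a \<Rightarrow> real" where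
  "ode_energy m n q F y v =
     (2 * n + m * q) * F + inner (q *\<^sub>R y - n *\<^sub>R v) (q *\<^sub>R y - n *\<^sub>R v) / 2 + n\<^sup>2 / 2 * inner v v"

definition ode_energy_rate :: "real \<Rightarrow> real \<Rightarrow> real \<Rightarrow> 'a::euclidean_space \<Rightarrow> 'a \<Rightarrow> 'a \<Rightarrow> real" where
  "ode_energy_rate m n q y g v =
     - ((2 * n + m * q) * m * inner g g + (n + m * q) * q * inner g y + n\<^sup>2 * q * inner v v)"

text \<open>Strong convexity turns the dissipated \<open>inner g y\<close> into \<open>F\<close>
  plus a multiple of \<open>inner y y\<close>. The first pays for the potential; the second,
  together with the dissipated \<open>inner v v\<close>, pays for the shifted square and the kinetic
  term.\<close>

lemma ode_energy_rate_le:
  fixes y g v :: "'a::euclidean_space"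
  assumes "m \<ge> 0" "n > 0" "q > 0" "F \<ge> 0" "r \<ge> 0" "r \<le> q / 2" "r * q \<le> (n + m * q) * \<mu> / 2"
    and sc: "F + \<mu> / 2 * inner y y \<le> inner g y"
  shows "ode_energy_rate m n q y g v \<le> - r * ode_energy m n q F y v"
proof -
  define W where "W = q *\<^sub>R y - n *\<^sub>R v"
  \<comment> \<open>The parallelogram identity removes the mixed product of \<open>y\<close> and
    \<open>v\<close>.\<close>
  have "inner W W + inner (q *\<^sub>R y + n *\<^sub>R v) (q *\<^sub>R y + n *\<^sub>R v)
      = 2 * q\<^sup>2 * inner y y + 2 * n\<^sup>2 * inner v v"
    by (simp add: W_def inner_simps inner_commute power2_eq_square algebra_simps)
  then have W: "inner W W \<le> 2 * q\<^sup>2 * inner y y + 2 * n\<^sup>2 * inner v v"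
    by (smt (verit) inner_ge_zero)
  have "r * ((2 * n + m * q) * F) \<le> q / 2 * ((2 * n + m * q) * F)"
    using assms by (intro mult_right_mono) auto
  also have "\<dots> \<le> (n + m * q) * q * F"
    using assms by (simp add: algebra_simps)
  finally have 1: "r * ((2 * n + m * q) * F) \<le> (n + m * q) * q * F" .
  have "r * (inner W W / 2) \<le> r * (q\<^sup>2 * inner y y + n\<^sup>2 * inner v v)"
    using W assms by (intro mult_left_mono) auto
  also have "\<dots> = (r * q) * (q * inner y y) + r * (n\<^sup>2 * inner v v)"
    by (simp add: algebra_simps power2_eq_square)
  also have "\<dots> \<le> ((n + m * q) * \<mu> / 2) * (q * inner y y) + q / 2 * (n\<^sup>2 * inner v v)"
    using assms by (intro add_mono mult_right_mono) auto
  finally have 2: "r * (inner W W / 2)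
      \<le> (n + m * q) * q * (\<mu> / 2 * inner y y) + q / 2 * (n\<^sup>2 * inner v v)"
    by (simp add: algebra_simps)
  have 3: "r * (n\<^sup>2 / 2 * inner v v) \<le> q / 2 * (n\<^sup>2 / 2 * inner v v)"
    using assms by (intro mult_right_mono) auto
  have 4: "(n + m * q) * q * (F + \<mu> / 2 * inner y y) \<le> (n + m * q) * q * inner g y"
    using assms by (intro mult_left_mono) auto
  have 5: "0 \<le> (2 * n + m * q) * m * inner g g"
    using assms by simp
  have 6: "0 \<le> q * (n\<^sup>2 * inner v v)"
    using assms by simp
  have "r * ode_energy m n q F y v
      = r * ((2 * n + m * q) * F) + r * (inner W W / 2) + r * (n\<^sup>2 / 2 * inner v v)"
    by (simp add: ode_energy_def W_def distrib_left)
  also have "\<dots> \<le> (n + m * q) * q * (F + \<mu> / 2 * inner y y) + q * (n\<^sup>2 * inner v v)"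
    using 1 2 3 6 unfolding distrib_left by linarith
  finally show ?thesis
    using 4 5 unfolding ode_energy_rate_def by (simp add: mult.assoc mult.left_commute)
qed

lemma ode_energy_has_derivative:
  fixes f :: "'a::euclidean_space \<Rightarrow> real"
  assumes "ode_solution m n q f X V" "\<And>x. f differentiable (at x)" "t \<ge> 0"
  shows "((\<lambda>t. ode_energy m n q (f (X t) - c) (X t - z) (V t)) has_real_derivative
           ode_energy_rate m n q (X t - z) (grad f (X t)) (V t)) (at t within {0..})"
proof -
  define X' where "X' = - m *\<^sub>R grad f (X t) - n *\<^sub>R V t"
  define V' where "V' = grad f (X t) - q *\<^sub>R V t"
  have X: "(X has_derivative (\<lambda>h. h *\<^sub>R X')) (at t within {0..})"
    and V: "(V has_derivative (\<lambda>h. h *\<^sub>R V')) (at t within {0..})"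
    using assms(1,3) by (auto simp: ode_solution_def X'_def V'_def has_vector_derivative_def)
  have "(f has_derivative (\<lambda>h. inner h (grad f (X t)))) (at (X t))"
    using GDERIV_grad[OF assms(2)] by (simp add: gderiv_def)
  from has_derivative_compose[OF X this]
  have f: "((\<lambda>t. f (X t)) has_derivative (\<lambda>h. inner (h *\<^sub>R X') (grad f (X t)))) (at t within {0..})" .
  note [derivative_intros] = X V f
  have "((\<lambda>t. ode_energy m n q (f (X t) - c) (X t - z) (V t)) has_derivative
      (\<lambda>h. h * ode_energy_rate m n q (X t - z) (grad f (X t)) (V t))) (at t within {0..})"
    unfolding ode_energy_def
    by (auto intro!: derivative_eq_intros simp: fun_eq_iff ode_energy_rate_def X'_def V'_def
        inner_simps inner_commute power2_eq_square field_simps)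
  then show ?thesis
    by (simp add: has_field_derivative_def mult_commute_abs)
qed

lemma ode_solution_exponential_decay:
  fixes f :: "'a::euclidean_space \<Rightarrow> real"
  assumes "\<mu> > 0" "strongly_convex \<mu> f" "ode_solution m n q f X V" "grad f z = 0"
    and "m \<ge> 0" "n > 0" "q > 0" "\<gamma> \<ge> 0" "4 * \<gamma> \<le> q" "4 * \<gamma> * q \<le> (n + m * q) * \<mu>"
  obtains C where "C \<ge> 0" "\<And>t. t \<ge> 0 \<Longrightarrow> norm (X t - z) \<le> C * exp (- \<gamma> * t)"
proof -
  define E where "E t = ode_energy m n q (f (X t) - f z) (X t - z) (V t)" for t
  define E' where "E' t = ode_energy_rate m n q (X t - z) (grad f (X t)) (V t)" for t
  have sc: "f x + inner (grad f x) (y - x) + \<mu> / 2 * (norm (y - x))\<^sup>2 \<le> f y"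
    and diff: "f differentiable (at x)" for x y
    using assms(2) by (auto simp: strongly_convex_def)
  have gap: "\<mu> / 2 * (norm (x - z))\<^sup>2 \<le> f x - f z" for x
    using sc[of z x] assms(4) by simp
  then have gap0: "0 \<le> f x - f z" for x
    using assms(1) by (meson order_trans mult_nonneg_nonneg zero_le_power2 less_imp_le half_gt_zero)
  have slope: "f x - f z + \<mu> / 2 * inner (x - z) (x - z) \<le> inner (grad f x) (x - z)" for x
    using sc[of x z] by (simp add: power2_norm_eq_inner inner_simps algebra_simps)
  \<comment> \<open>The rate lemma is applied with \<open>r = 2 * \<gamma>\<close>, which turns its
    two bounds on \<open>r\<close> into the assumed bounds on \<open>4 * \<gamma>\<close>.\<close>
  have E_rate: "E' t \<le> - (2 * \<gamma>) * E t" for t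
    unfolding E_def E'_def
    by (rule ode_energy_rate_le) (use assms gap0 slope in auto)
  have E_der: "(E has_real_derivative E' t) (at t within {0..})" if "t \<ge> 0" for t
    unfolding E_def E'_def by (rule ode_energy_has_derivative) (use assms diff that in auto)
  \<comment> \<open>Gronwall argument by the mean value theorem on \<open>{0..t}\<close>, with
    derivatives within the interval because at \<open>0\<close> they are one-sided.\<close>
  have decay: "exp (2 * \<gamma> * t) * E t \<le> E 0" if "t \<ge> 0" for t
  proof (cases "t = 0")
    case False
    let ?d = "\<lambda>s. exp (2 * \<gamma> * s) * (2 * \<gamma> * E s + E' s)"
    have "((\<lambda>s. exp (2 * \<gamma> * s) * E s) has_derivative (*) (?d s)) (at s within {0..t})"
      if "s \<in> {0..t}" for s
      using that
      by (auto intro!: derivative_eq_intros DERIV_subset[OF E_der]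
          simp flip: has_field_derivative_def simp: algebra_simps)
    then obtain s where "exp (2 * \<gamma> * t) * E t - exp (2 * \<gamma> * 0) * E 0 = ?d s * (t - 0)"
      using mvt_simple[of 0 t "\<lambda>s. exp (2 * \<gamma> * s) * E s" "\<lambda>s. (*) (?d s)"] False \<open>t \<ge> 0\<close> by auto
    moreover have "?d s * (t - 0) \<le> 0"
      using E_rate[of s] \<open>t \<ge> 0\<close> by (intro mult_nonpos_nonneg mult_nonneg_nonpos) auto
    ultimately show ?thesis by simp
  qed simp
  define A where "A = (2 * n + m * q) * \<mu> / 2"
  have A: "A > 0"
    using assms by (simp add: A_def add_pos_nonneg)
  have E_ge: "A * (norm (X t - z))\<^sup>2 \<le> E t" for t
  proof -
    have "A * (norm (X t - z))\<^sup>2 \<le> (2 * n + m * q) * (f (X t) - f z)"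
      using mult_left_mono[OF gap[of "X t"], of "2 * n + m * q"] assms by (simp add: A_def)
    then show ?thesis
      unfolding E_def ode_energy_def by (smt (verit) inner_ge_zero mult_nonneg_nonneg zero_le_power2 divide_nonneg_nonneg)
  qed
  have E0: "E 0 \<ge> 0"
    using E_ge[of 0] A by (smt (verit) mult_nonneg_nonneg zero_le_power2)
  have "norm (X t - z) \<le> sqrt (E 0 / A) * exp (- \<gamma> * t)" if "t \<ge> 0" for t
  proof (rule power2_le_imp_le)
    have "exp (2 * \<gamma> * t) * (A * (norm (X t - z))\<^sup>2) \<le> E 0"
      using decay[OF that] E_ge[of t] by (meson exp_ge_zero mult_left_mono order_trans)
    then have "(norm (X t - z))\<^sup>2 \<le> E 0 / A * exp (- (2 * \<gamma> * t))"
      using A by (simp add: exp_minus field_simps)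
    also have "\<dots> = (sqrt (E 0 / A) * exp (- \<gamma> * t))\<^sup>2"
      using A E0 by (simp add: power_mult_distrib flip: exp_double)
    finally show "(norm (X t - z))\<^sup>2 \<le> (sqrt (E 0 / A) * exp (- \<gamma> * t))\<^sup>2" .
  qed (use A E0 in auto)
  then show thesis
    using that[of "sqrt (E 0 / A)"] A E0 by simp
qed

section \<open>Linear convergence of the semi-implicit scheme\<close>

text \<open>Rescaled parameters \<open>a = m \<surd>s\<close>, \<open>b = n s\<close>, \<open>p = q \<surd>s\<close>, \<open>u = v / \<surd>s\<close>. The weight makes the
coefficient of \<open>inner g' u'\<close> in the energy difference vanish. In the energy, subtracting \<open>(a p) g\<close>
turns \<open>p y - b u\<close> into a quantity whose increment is exactly \<open>-(a p + b) g'\<close>, and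
the correction \<open>- a / 2 * inner g g\<close> absorbs the squared gradients from the potential step when
\<open>p\<close> is not small.\<close>

definition sie_weight :: "real \<Rightarrow> real \<Rightarrow> real \<Rightarrow> real" where
  "sie_weight a b p = (1 - p) * (a * p + b) + 3 / 5 * b / (1 - p)"

definition sie_energy :: "real \<Rightarrow> real \<Rightarrow> real \<Rightarrow> real \<Rightarrow> 'a::euclidean_space \<Rightarrow> 'a \<Rightarrow> 'a \<Rightarrow> real" where
  "sie_energy a b p F y g u =
     sie_weight a b p * (F - a / 2 * inner g g)
     + inner (p *\<^sub>R y - b *\<^sub>R u - (a * p) *\<^sub>R g) (p *\<^sub>R y - b *\<^sub>R u - (a * p) *\<^sub>R g) / 2
     + 3 / 10 * b\<^sup>2 * inner u u"

text \<open>Primes mark the next iterate. All three parts of the energy difference are rewritten in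
  the new values, using that the old \<open>u\<close> is \<open>(u' - g') / (1 - p)\<close>; then
  only the coefficients of the squares of \<open>u'\<close> and \<open>g'\<close> have to be bounded
  from below.\<close>

lemma sie_energy_decrease:
  fixes y g u y' g' u' :: "'a::euclidean_space"
  assumes "0 < b" "b \<le> a" "0 < p" "p \<le> 1 / 2"
    and y': "y' = y - a *\<^sub>R g - b *\<^sub>R u" and u': "u' = (1 - p) *\<^sub>R u + g'"
    and F: "F' + inner g' (y - y') + a / 2 * inner (g - g') (g - g') \<le> F"
  shows "(a * p + b) * p * inner g' y' + 3 / 5 * b\<^sup>2 * p * inner u' u'
           + (a * p + b) * a * (1 - 3 * p) / 2 * inner g' g'
         \<le> sie_energy a b p F y g u - sie_energy a b p F' y' g' u'"
proof -
  define B where "B = a * p + b"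
  define A where "A = sie_weight a b p"
  define r where "r = 1 - p"
  define W where "W = p *\<^sub>R y - b *\<^sub>R u - (a * p) *\<^sub>R g"
  define W' where "W' = p *\<^sub>R y' - b *\<^sub>R u' - (a * p) *\<^sub>R g'"
  define Q G U where "Q = inner g' u'" and "G = inner g' g'" and "U = inner u' u'"
  have r: "1 / 2 \<le> r" "r < 1" and B: "B > 0"
    using assms by (auto simp: r_def B_def add_nonneg_pos)
  have A: "A = r * B + 3 / 5 * b / r"
    by (simp add: A_def sie_weight_def r_def B_def)
  have A0: "A > 0"
    using r B assms by (auto simp: A intro!: add_pos_pos)
  have u: "u = (1 / r) *\<^sub>R (u' - g')"
    using r by (simp add: u' r_def)
  \<comment> \<open>The product \<open>inner g' g\<close> produced by the position step cancels
    against the one in the square of \<open>g - g'\<close>. The correction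
    \<open>- a / 2 * inner g g\<close> absorbs the remaining square of the old gradient.\<close>
  have potential: "A * (b * (Q - G) / r + a * G)
      \<le> A * (F - a / 2 * inner g g) - A * (F' - a / 2 * inner g' g')"
  proof -
    have "inner g' u = (Q - G) / r"
      by (simp add: u Q_def G_def inner_simps diff_divide_distrib)
    moreover have "inner g' (y - y') = a * inner g' g + b * inner g' u"
      by (simp add: y' inner_simps)
    ultimately have "b * (Q - G) / r + a * G \<le> F - a / 2 * inner g g - (F' - a / 2 * inner g' g')"
      using F by (simp add: G_def inner_simps inner_commute algebra_simps)
    then show ?thesis
      using A0 by (simp flip: right_diff_distrib)
  qed
  have cross: "inner W W / 2 - inner W' W' / 2
      = B * (p * inner g' y' - b * Q - a * p * G) + B\<^sup>2 / 2 * G"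
  proof -
    have "W = W' + B *\<^sub>R g'"
      by (simp add: W_def W'_def B_def y' u' algebra_simps)
    then have "inner W W / 2 - inner W' W' / 2 = B * inner g' W' + B\<^sup>2 / 2 * G"
      by (simp add: G_def inner_simps inner_commute power2_eq_square algebra_simps)
    moreover have "inner g' W' = p * inner g' y' - b * Q - a * p * G"
      by (simp add: W'_def Q_def G_def inner_simps)
    ultimately show ?thesis by simp
  qed
  have kinetic: "inner u u - inner u' u' = (1 / r\<^sup>2 - 1) * U - 2 * Q / r\<^sup>2 + G / r\<^sup>2"
    using r by (simp add: u Q_def G_def U_def inner_simps inner_commute power2_eq_square field_simps)
  \<comment> \<open>The coefficient of \<open>Q\<close> is
    \<open>A * b / r - B * b - 3 / 5 * b\<^sup>2 / r\<^sup>2\<close>, which is zero by the choice of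
    the weight \<open>A\<close>.\<close>
  have sum: "A * (b * (Q - G) / r + a * G)
      + (B * (p * inner g' y' - b * Q - a * p * G) + B\<^sup>2 / 2 * G)
      + 3 / 10 * b\<^sup>2 * ((1 / r\<^sup>2 - 1) * U - 2 * Q / r\<^sup>2 + G / r\<^sup>2)
    = B * p * inner g' y' + 3 / 10 * b\<^sup>2 * (1 / r\<^sup>2 - 1) * U
      + (a * A - B\<^sup>2 / 2 - 3 / 10 * b\<^sup>2 / r\<^sup>2) * G"
  proof -
    have "A * (b * (Q - G) / r) = B * b * (Q - G) + 3 / 5 * b\<^sup>2 / r\<^sup>2 * (Q - G)"
      using r by (simp add: A power2_eq_square field_simps)
    moreover have "B * (B * G) = B * (a * p * G) + B * (b * G)"
      by (simp add: B_def algebra_simps)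
    ultimately show ?thesis
      by (simp add: algebra_simps power2_eq_square add_divide_distrib diff_divide_distrib)
  qed
  \<comment> \<open>This rests on the identity
    \<open>1 - (1 + 2 * p) * (1 - p)\<^sup>2 = p\<^sup>2 * (3 - 2 * p)\<close>.\<close>
  have "2 * p \<le> 1 / r\<^sup>2 - 1"
  proof -
    have "0 \<le> p\<^sup>2 * (3 - 2 * p)"
      using assms by (intro mult_nonneg_nonneg) auto
    then have "(1 + 2 * p) * r\<^sup>2 \<le> 1"
      by (simp add: r_def power2_eq_square algebra_simps)
    then show ?thesis
      using r by (simp add: field_simps)
  qed
  then have "3 / 10 * b\<^sup>2 * U * (2 * p) \<le> 3 / 10 * b\<^sup>2 * U * (1 / r\<^sup>2 - 1)"
    by (intro mult_left_mono) (simp_all add: U_def)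
  then have c1: "3 / 5 * b\<^sup>2 * p * U \<le> 3 / 10 * b\<^sup>2 * (1 / r\<^sup>2 - 1) * U"
    by (simp add: algebra_simps)
  \<comment> \<open>From \<open>b \<le> a\<close> follows \<open>B \<le> a * (1 + p)\<close>, and
    \<open>(1 - p) - (1 + p) / 2 = (1 - 3 * p) / 2\<close>. The second summand of \<open>A\<close>
    pays for the kinetic loss since \<open>b \<le> 2 * r * a\<close>.\<close>
  have "B * a * (1 - 3 * p) / 2 \<le> a * A - B\<^sup>2 / 2 - 3 / 10 * b\<^sup>2 / r\<^sup>2"
  proof -
    have "b * b \<le> (2 * r) * a * b"
    proof -
      have "1 * a \<le> (2 * r) * a"
        using assms r by (intro mult_right_mono) auto
      then have "b \<le> (2 * r) * a" using assms(2) by linarith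
      then show ?thesis using assms by (intro mult_right_mono) auto
    qed
    then have "3 / 10 * b\<^sup>2 / r\<^sup>2 \<le> 3 / 5 * a * b / r"
      using r by (simp add: field_simps power2_eq_square)
    moreover have "B * B \<le> B * (a * (1 + p))"
      using assms B by (intro mult_left_mono) (auto simp: B_def algebra_simps)
    moreover have "a * A = B * (a * r) + 3 / 5 * a * b / r"
      by (simp add: A algebra_simps)
    moreover have "B * a * (1 - 3 * p) / 2 = B * (a * r) - B * (a * (1 + p)) / 2"
      by (simp add: r_def field_simps)
    ultimately show ?thesis
      unfolding power2_eq_square by linarith
  qed
  then have c2: "B * a * (1 - 3 * p) / 2 * G \<le> (a * A - B\<^sup>2 / 2 - 3 / 10 * b\<^sup>2 / r\<^sup>2) * G"
    by (intro mult_right_mono) (simp_all add: G_def)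
  have "B * p * inner g' y' + 3 / 5 * b\<^sup>2 * p * U + B * a * (1 - 3 * p) / 2 * G
      \<le> B * p * inner g' y' + 3 / 10 * b\<^sup>2 * (1 / r\<^sup>2 - 1) * U
        + (a * A - B\<^sup>2 / 2 - 3 / 10 * b\<^sup>2 / r\<^sup>2) * G"
    using c1 c2 by (intro add_mono order_refl)
  also note sum[symmetric]
  also have "A * (b * (Q - G) / r + a * G)
        + (B * (p * inner g' y' - b * Q - a * p * G) + B\<^sup>2 / 2 * G)
        + 3 / 10 * b\<^sup>2 * ((1 / r\<^sup>2 - 1) * U - 2 * Q / r\<^sup>2 + G / r\<^sup>2)
      \<le> A * (F - a / 2 * inner g g) - A * (F' - a / 2 * inner g' g')
        + (inner W W / 2 - inner W' W' / 2) + 3 / 10 * b\<^sup>2 * (inner u u - inner u' u')"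
    unfolding cross kinetic using potential by (intro add_mono order_refl)
  also have "\<dots> = sie_energy a b p F y g u - sie_energy a b p F' y' g' u'"
    by (simp add: sie_energy_def A_def W_def W'_def algebra_simps diff_divide_distrib)
  finally show ?thesis
    by (simp add: B_def G_def U_def)
qed

text \<open>The right-hand side is the amount dissipated in one step. The constant
  \<open>21 / 50\<close> is \<open>1 / 5\<close> times \<open>21 / 10\<close>, the latter bounding
  \<open>((1 + \<gamma>)\<^sup>2 - 1) / \<gamma>\<close> for
  \<open>0 < \<gamma> \<le> 1 / 10\<close>. The coefficients of \<open>inner u u\<close> fit because
  \<open>21 / 50 + 63 / 500 \<le> 3 / 5\<close>.\<close>

lemma sie_energy_le:
  fixes y g u :: "'a::euclidean_space"
  assumes "0 < b" "b \<le> a" "0 < p" "p \<le> 1 / 2" "0 \<le> \<rho>"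
    and \<rho>: "\<rho> \<le> 21 / 50 * p" "\<rho> * p \<le> 21 / 50 * b * \<mu>"
    and F: "F + \<mu> / 2 * inner y y \<le> inner g y" "a * inner g g \<le> F" and "\<mu> \<ge> 0"
  shows "\<rho> * sie_energy a b p F y g u
         \<le> (a * p + b) * p * inner g y + 3 / 5 * b\<^sup>2 * p * inner u u
           + (a * p + b) * a * (1 - 3 * p) / 2 * inner g g"
proof -
  define B where "B = a * p + b"
  define A where "A = sie_weight a b p"
  define W where "W = p *\<^sub>R y - b *\<^sub>R u - (a * p) *\<^sub>R g"
  define G U Y where "G = inner g g" and "U = inner u u" and "Y = inner y y"
  have nonneg: "0 \<le> G" "0 \<le> U" "0 \<le> Y"
    by (simp_all add: G_def U_def Y_def)
  have B: "b \<le> B" "0 < B"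
    using assms by (auto simp: B_def add_nonneg_pos)
  \<comment> \<open>The factor is \<open>1 + 6 / 5\<close>, from \<open>1 / (1 - p) \<le> 2\<close>
    and \<open>b \<le> B\<close>. It suffices because \<open>21 / 50 * (11 / 5) = 231 / 250\<close>
    is below \<open>1\<close>.\<close>
  have "A \<le> 11 / 5 * B"
  proof -
    have "3 / 5 * b / (1 - p) \<le> 6 / 5 * b"
      using assms by (simp add: field_simps)
    moreover have "(1 - p) * B \<le> 1 * B"
      using assms B by (intro mult_right_mono) auto
    ultimately show ?thesis
      using B unfolding A_def sie_weight_def B_def[symmetric] by linarith
  qed
  then have "\<rho> * A \<le> (21 / 50 * p) * (11 / 5 * B)"
    using \<rho> assms B by (intro mult_mono) (auto simp: A_def sie_weight_def intro!: add_nonneg_nonneg)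
  also have "\<dots> \<le> B * p"
    using B assms by simp
  finally have "\<rho> * A \<le> B * p" .
  moreover have aG: "0 \<le> a * G"
    using nonneg assms by simp
  ultimately have 1: "\<rho> * A * (F - a / 2 * G) \<le> B * p * (F - a / 2 * G)"
    using F(2) by (intro mult_right_mono) (auto simp: G_def)
  \<comment> \<open>Parallelogram identity for \<open>p *\<^sub>R (y - a *\<^sub>R g)\<close> and
    \<open>b *\<^sub>R u\<close>. The gradient step \<open>y - a *\<^sub>R g\<close> is then no
    longer than \<open>y\<close>, as \<open>2 * inner g y\<close> is at least
    \<open>a * G\<close>.\<close>
  have "inner W W + inner (p *\<^sub>R (y - a *\<^sub>R g) + b *\<^sub>R u) (p *\<^sub>R (y - a *\<^sub>R g) + b *\<^sub>R u)
      = 2 * p\<^sup>2 * (Y - a * (2 * inner g y - a * G)) + 2 * b\<^sup>2 * U"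
    by (simp add: W_def Y_def G_def U_def inner_simps inner_commute power2_eq_square algebra_simps)
  then have "inner W W \<le> 2 * p\<^sup>2 * (Y - a * (2 * inner g y - a * G)) + 2 * b\<^sup>2 * U"
    by (smt (verit) inner_ge_zero)
  moreover have "2 * p\<^sup>2 * (Y - a * (2 * inner g y - a * G)) \<le> 2 * p\<^sup>2 * Y"
  proof -
    have "0 \<le> \<mu> / 2 * Y" using nonneg assms by simp
    then have "0 \<le> 2 * inner g y - a * G"
      using F aG by (simp add: G_def Y_def)
    then show ?thesis using assms by (intro mult_left_mono) auto
  qed
  ultimately have "inner W W / 2 \<le> p\<^sup>2 * Y + b\<^sup>2 * U"
    by simp
  then have "\<rho> * (inner W W / 2) \<le> \<rho> * (p\<^sup>2 * Y + b\<^sup>2 * U)"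
    using assms by (intro mult_left_mono) auto
  also have "\<dots> = (\<rho> * p) * (p * Y) + \<rho> * (b\<^sup>2 * U)"
    by (simp add: power2_eq_square algebra_simps)
  also have "\<dots> \<le> (21 / 50 * b * \<mu>) * (p * Y) + (21 / 50 * p) * (b\<^sup>2 * U)"
    using \<rho> assms nonneg by (intro add_mono mult_right_mono) auto
  also have "(21 / 50 * b * \<mu>) * (p * Y) \<le> (B / 2 * \<mu>) * (p * Y)"
    using B assms nonneg by (intro mult_right_mono) auto
  finally have 2: "\<rho> * (inner W W / 2) \<le> B * p * (\<mu> / 2 * Y) + 21 / 50 * p * (b\<^sup>2 * U)"
    by (simp add: algebra_simps)
  have "\<rho> * (3 / 10 * b\<^sup>2 * U) \<le> (21 / 50 * p) * (3 / 10 * b\<^sup>2 * U)"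
    using \<rho> nonneg by (intro mult_right_mono) auto
  then have 3: "\<rho> * (3 / 10 * b\<^sup>2 * U) \<le> 63 / 500 * (p * (b\<^sup>2 * U))"
    by (simp add: algebra_simps)
  have 4: "B * p * (F + \<mu> / 2 * Y) \<le> B * p * inner g y"
    using F(1) B assms by (intro mult_left_mono) (auto simp: Y_def)
  \<comment> \<open>For \<open>p > 1 / 3\<close> the term with \<open>1 - 3 * p\<close> is negative.
    The correction inside the energy compensates for it:
    \<open>(1 - 3 * p) / 2 + p / 2 = (1 - 2 * p) / 2\<close>, which is nonnegative.\<close>
  have 5: "0 \<le> B * (a * G) * (1 - 2 * p) / 2"
    using B assms nonneg by (intro divide_nonneg_nonneg mult_nonneg_nonneg) auto
  have 6: "0 \<le> p * (b\<^sup>2 * U)"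
    using assms nonneg by simp
  have "\<rho> * sie_energy a b p F y g u
      = \<rho> * A * (F - a / 2 * G) + \<rho> * (inner W W / 2) + \<rho> * (3 / 10 * b\<^sup>2 * U)"
    by (simp add: sie_energy_def A_def W_def G_def U_def algebra_simps)
  also have "\<dots> \<le> B * p * (F + \<mu> / 2 * Y) - B * p * (a / 2 * G) + 3 / 5 * (p * (b\<^sup>2 * U))"
    using 1 2 3 6 unfolding distrib_left right_diff_distrib by linarith
  also have "\<dots> \<le> B * p * inner g y + B * (a * G) * (1 - 2 * p) / 2
      - B * p * (a / 2 * G) + 3 / 5 * (p * (b\<^sup>2 * U))"
    using 4 5 by linarith
  also have "\<dots> = B * p * inner g y + 3 / 5 * b\<^sup>2 * p * U + B * a * (1 - 3 * p) / 2 * G"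
    by (simp add: field_simps)
  finally show ?thesis
    by (simp add: B_def G_def U_def)
qed

lemma sie_linear_convergence:
  fixes f :: "'a::euclidean_space \<Rightarrow> real"
  assumes "\<mu> > 0" "strongly_convex \<mu> f" "L_smooth L f" "grad f z = 0"
    and "0 < b" "b \<le> a" "a \<le> 1 / (2 * L)" "0 < p" "p \<le> 1 / 2"
    and "0 \<le> \<gamma>" "5 * \<gamma> \<le> p" "5 * \<gamma> * p \<le> b * \<mu>"
    and x: "\<And>k. x (Suc k) = x k - a *\<^sub>R grad f (x k) - b *\<^sub>R u k"
    and u: "\<And>k. u (Suc k) = (1 - p) *\<^sub>R u k + grad f (x (Suc k))"
  obtains C where "C \<ge> 0" "\<And>k. norm (x k - z) \<le> C / (1 + \<gamma>) ^ k"
proof -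
  have "0 < 1 / (2 * L)"
    using assms by linarith
  then have L: "L > 0"
    by (simp add: zero_less_divide_iff)
  define g where "g k = grad f (x k)" for k
  define F where "F k = f (x k) - f z" for k
  define E where "E k = sie_energy a b p (F k) (x k - z) (g k) (u k)" for k
  have sc: "f w + inner (grad f w) (y - w) + \<mu> / 2 * (norm (y - w))\<^sup>2 \<le> f y" for w y
    using assms(2) by (auto simp: strongly_convex_def)
  have coc: "f w + inner (grad f w) (y - w) + a * (norm (grad f y - grad f w))\<^sup>2 \<le> f y" for w y
  proof -
    have "a * (norm (grad f y - grad f w))\<^sup>2 \<le> 1 / (2 * L) * (norm (grad f y - grad f w))\<^sup>2"
      using assms by (intro mult_right_mono) auto
    then show ?thesis
      using strongly_convex_imp_cocoercive[of \<mu> f L w y] assms L by simp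
  qed
  have F_ge: "a * inner (g k) (g k) \<le> F k" for k
    using coc[of z "x k"] assms(4) by (simp add: F_def g_def power2_norm_eq_inner)
  have F_le: "F k + \<mu> / 2 * inner (x k - z) (x k - z) \<le> inner (g k) (x k - z)" for k
    using sc[of "x k" z] by (simp add: F_def g_def power2_norm_eq_inner inner_simps algebra_simps)
  \<comment> \<open>The energy controls the squared distance, so it has to shrink by
    \<open>1 + \<rho> = (1 + \<gamma>)\<^sup>2\<close> in each step.\<close>
  define \<rho> where "\<rho> = (1 + \<gamma>)\<^sup>2 - 1"
  have \<gamma>: "\<gamma> \<le> 1 / 10"
    using assms by simp
  have \<rho>_le: "\<rho> \<le> 21 / 10 * \<gamma>"
    using mult_right_mono[OF \<gamma> assms(10)] by (simp add: \<rho>_def power2_eq_square algebra_simps)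
  have \<rho>0: "0 \<le> \<rho>"
    using assms(10) by (simp add: \<rho>_def)
  have \<rho>p: "\<rho> * p \<le> 21 / 50 * b * \<mu>"
  proof -
    have "\<rho> * p \<le> 21 / 10 * \<gamma> * p"
      using \<rho>_le assms by (intro mult_right_mono) auto
    then show ?thesis
      using assms(12) by linarith
  qed
  have step: "(1 + \<gamma>)\<^sup>2 * E (Suc k) \<le> E k" for k
  proof -
    have "F (Suc k) + inner (g (Suc k)) ((x k - z) - (x (Suc k) - z))
        + a / 2 * inner (g k - g (Suc k)) (g k - g (Suc k)) \<le> F k"
    proof -
      have "0 \<le> a * inner (g k - g (Suc k)) (g k - g (Suc k))"
        using assms by simp
      then show ?thesis
        using coc[of "x (Suc k)" "x k"] by (simp add: F_def g_def power2_norm_eq_inner)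
    qed
    then have "(a * p + b) * p * inner (g (Suc k)) (x (Suc k) - z) + 3 / 5 * b\<^sup>2 * p * inner (u (Suc k)) (u (Suc k))
           + (a * p + b) * a * (1 - 3 * p) / 2 * inner (g (Suc k)) (g (Suc k)) \<le> E k - E (Suc k)"
      unfolding E_def using assms by (intro sie_energy_decrease) (auto simp: g_def)
    moreover have "\<rho> * E (Suc k) \<le> (a * p + b) * p * inner (g (Suc k)) (x (Suc k) - z)
           + 3 / 5 * b\<^sup>2 * p * inner (u (Suc k)) (u (Suc k))
           + (a * p + b) * a * (1 - 3 * p) / 2 * inner (g (Suc k)) (g (Suc k))"
      unfolding E_def by (rule sie_energy_le[OF assms(5,6,8,9) \<rho>0 _ \<rho>p F_le F_ge]) (use assms(1,11) \<rho>_le in auto)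
    ultimately have "\<rho> * E (Suc k) \<le> E k - E (Suc k)"
      by linarith
    then show ?thesis by (simp add: \<rho>_def algebra_simps)
  qed
  have decay: "((1 + \<gamma>) ^ k)\<^sup>2 * E k \<le> E 0" for k
  proof (induction k)
    case (Suc k)
    have "((1 + \<gamma>) ^ Suc k)\<^sup>2 * E (Suc k) = ((1 + \<gamma>) ^ k)\<^sup>2 * ((1 + \<gamma>)\<^sup>2 * E (Suc k))"
      by (simp add: power_mult_distrib)
    also have "\<dots> \<le> ((1 + \<gamma>) ^ k)\<^sup>2 * E k"
      using step by (intro mult_left_mono) auto
    finally show ?case using Suc by simp
  qed simp
  \<comment> \<open>By \<open>F_ge\<close> the corrected potential is at least half of
    \<open>F\<close>, which leaves \<open>\<mu> / 4\<close> of the strong convexity constant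
    \<open>\<mu> / 2\<close>.\<close>
  define A where "A = sie_weight a b p * (\<mu> / 4)"
  have w: "sie_weight a b p > 0"
    unfolding sie_weight_def using assms by (intro add_pos_pos mult_pos_pos divide_pos_pos) auto
  then have A: "A > 0"
    using assms by (simp add: A_def)
  have E_ge: "A * (norm (x k - z))\<^sup>2 \<le> E k" for k
  proof -
    have "\<mu> / 4 * (norm (x k - z))\<^sup>2 \<le> F k - a / 2 * inner (g k) (g k)"
      using sc[of z "x k"] F_ge[of k] assms(4) by (simp add: F_def)
    then have "A * (norm (x k - z))\<^sup>2 \<le> sie_weight a b p * (F k - a / 2 * inner (g k) (g k))"
      using w by (simp add: A_def mult.assoc)
    then show ?thesis
      unfolding E_def sie_energy_def by (smt (verit) inner_ge_zero mult_nonneg_nonneg zero_le_power2 divide_nonneg_nonneg)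
  qed
  have E0: "E 0 \<ge> 0"
    using E_ge[of 0] A by (smt (verit) mult_nonneg_nonneg zero_le_power2)
  have pos: "(1 + \<gamma>) ^ k > 0" for k
    using assms by simp
  have "norm (x k - z) \<le> sqrt (E 0 / A) / (1 + \<gamma>) ^ k" for k
  proof (rule power2_le_imp_le)
    have "((1 + \<gamma>) ^ k)\<^sup>2 * (A * (norm (x k - z))\<^sup>2) \<le> E 0"
      using decay[of k] E_ge[of k] by (meson zero_le_power2 mult_left_mono order_trans)
    then have "(norm (x k - z))\<^sup>2 \<le> E 0 / A / ((1 + \<gamma>) ^ k)\<^sup>2"
      using mult_pos_pos[OF A zero_less_power[OF pos[of k], of 2]]
      by (simp add: pos_le_divide_eq mult_ac del: zero_less_mult_iff)
    also have "\<dots> = (sqrt (E 0 / A) / (1 + \<gamma>) ^ k)\<^sup>2"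
      using A E0 by (simp add: power_divide)
    finally show "(norm (x k - z))\<^sup>2 \<le> (sqrt (E 0 / A) / (1 + \<gamma>) ^ k)\<^sup>2" .
  qed (use A E0 pos[of k] in simp)
  then show thesis
    using that[of "sqrt (E 0 / A)"] A E0 by simp
qed

text \<open>Translation to the rescaled parameters, where \<open>\<gamma> * sqrt s\<close> takes the
  place of \<open>\<gamma>\<close>: the two rate conditions get multiplied by \<open>sqrt s\<close>
  and \<open>s\<close>.\<close>

lemma semi_implicit_euler_linear_convergence:
  fixes f :: "'a::euclidean_space \<Rightarrow> real"
  assumes "\<mu> > 0" "strongly_convex \<mu> f" "L_smooth L f" "grad f z = 0" "s > 0"
    and "m * sqrt s \<le> 1 / (2 * L)" "0 < n * s" "n * s \<le> m * sqrt s"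
    and "0 < q * sqrt s" "q * sqrt s \<le> 1 / 2"
    and "0 \<le> \<gamma>" "5 * \<gamma> \<le> q" "5 * \<gamma> * q \<le> n * \<mu>"
    and "semi_implicit_euler m n q s f x v"
  obtains C where "C \<ge> 0" "\<And>k. norm (x k - z) \<le> C / (1 + \<gamma> * sqrt s) ^ k"
proof -
  have h: "sqrt s > 0" "sqrt s * sqrt s = s"
    using assms by auto
  have "v (Suc k) = (1 - q * sqrt s) *\<^sub>R v k + sqrt s *\<^sub>R grad f (x (Suc k))" for k
  proof -
    have "v (Suc k) - v k = sqrt s *\<^sub>R grad f (x (Suc k)) - (q * sqrt s) *\<^sub>R v k"
      using assms(14) unfolding semi_implicit_euler_def by blast
    then show ?thesis
      by (simp add: algebra_simps)
  qed
  then have u: "(1 / sqrt s) *\<^sub>R v (Suc k)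
      = (1 - q * sqrt s) *\<^sub>R ((1 / sqrt s) *\<^sub>R v k) + grad f (x (Suc k))" for k
    using h by (simp add: scaleR_right_distrib)
  have x: "x (Suc k) = x k - (m * sqrt s) *\<^sub>R grad f (x k) - (n * s) *\<^sub>R ((1 / sqrt s) *\<^sub>R v k)" for k
  proof -
    have "x (Suc k) - x k = - (m * sqrt s) *\<^sub>R grad f (x k) - (n * sqrt s) *\<^sub>R v k"
      using assms(14) unfolding semi_implicit_euler_def by blast
    moreover have "n * s / sqrt s = n * sqrt s"
      using assms(5) by (simp add: real_div_sqrt flip: times_divide_eq_right)
    ultimately show ?thesis
      by (simp add: algebra_simps)
  qed
  have p: "5 * (\<gamma> * sqrt s) \<le> q * sqrt s"
    using mult_right_mono[OF assms(12), of "sqrt s"] h by (simp add: mult.assoc)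
  have b: "5 * (\<gamma> * sqrt s) * (q * sqrt s) \<le> n * s * \<mu>"
  proof -
    have "5 * (\<gamma> * sqrt s) * (q * sqrt s) = 5 * \<gamma> * q * (sqrt s * sqrt s)"
      by (simp only: mult_ac)
    also have "\<dots> \<le> n * \<mu> * s"
      unfolding h(2) using assms(5,13) by (intro mult_right_mono) auto
    finally show ?thesis
      by (simp only: mult_ac)
  qed
  have \<gamma>: "0 \<le> \<gamma> * sqrt s"
    using assms(5,11) by simp
  show thesis
    by (rule sie_linear_convergence[OF assms(1-4,7,8,6,9,10) \<gamma> p b, of x "\<lambda>k. (1 / sqrt s) *\<^sub>R v k"])
      (rule x u that; assumption?)+
qed

section \<open>Reduction of the explicit scheme to the semi-implicit one\<close>

text \<open>Shifting the velocity index by one makes its update use the gradient at the new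
  position. Solving the velocity update for \<open>v k\<close> and substituting into the position
  update yields the new parameters; the position index stays the same.\<close>

lemma explicit_euler_imp_semi_implicit_euler:
  assumes "explicit_euler m n q s f x v" "s > 0" "q * sqrt s < 1"
  shows "semi_implicit_euler (m - n * sqrt s / (1 - q * sqrt s)) (n / (1 - q * sqrt s)) q s f
           x (\<lambda>k. v (Suc k))"
  unfolding semi_implicit_euler_def
proof (intro allI conjI)
  fix k
  have x: "x (Suc k) - x k = - (m * sqrt s) *\<^sub>R grad f (x k) - (n * sqrt s) *\<^sub>R v k"
    and v: "v (Suc k) - v k = sqrt s *\<^sub>R grad f (x k) - (q * sqrt s) *\<^sub>R v k" for k
    using assms(1) unfolding explicit_euler_def by blast+
  show "v (Suc (Suc k)) - v (Suc k) = sqrt s *\<^sub>R grad f (x (Suc k)) - (q * sqrt s) *\<^sub>R v (Suc k)"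
    by (rule v)
  define r where "r = 1 - q * sqrt s"
  have r: "r > 0" using assms by (simp add: r_def)
  have "r *\<^sub>R v k = v (Suc k) - sqrt s *\<^sub>R grad f (x k)"
    using v[of k] by (simp add: r_def algebra_simps)
  then have "v k = (1 / r) *\<^sub>R (v (Suc k) - sqrt s *\<^sub>R grad f (x k))"
    using r by (metis eq_vector_fraction_iff less_irrefl scaleR_one scaleR_scaleR divide_inverse mult_1)
  then have "(n * sqrt s) *\<^sub>R v k
      = (n * sqrt s / r) *\<^sub>R v (Suc k) - (n * sqrt s / r * sqrt s) *\<^sub>R grad f (x k)"
    by (simp add: scaleR_right_diff_distrib)
  then show "x (Suc k) - x k = - ((m - n * sqrt s / (1 - q * sqrt s)) * sqrt s) *\<^sub>R grad f (x k)
      - (n / (1 - q * sqrt s) * sqrt s) *\<^sub>R v (Suc k)"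
    unfolding x r_def[symmetric] by (simp add: algebra_simps)
qed

section \<open>Comparison of trajectory and iterates\<close>

text \<open>Since \<open>1 + \<gamma> * h \<le> exp (\<gamma> * h)\<close>, the sampled trajectory
  approaches \<open>z\<close> at least as fast as the geometric rate.\<close>

lemma bigo_geometric:
  fixes a :: "nat \<Rightarrow> 'a::real_normed_vector"
  assumes "h > 0" "\<gamma> \<ge> 0" "C \<ge> 0" "D \<ge> 0"
    and X: "\<And>t. t \<ge> 0 \<Longrightarrow> norm (X t - z) \<le> C * exp (- \<gamma> * t)"
    and a: "\<And>k. norm (a k - z) \<le> D / (1 + \<gamma> * h) ^ k"
  shows "(\<lambda>k. norm (X (real k * h) - a k)) \<in> O(\<lambda>k. (1 + \<gamma> * h) powi (- int k))"
proof (rule bigoI[where c = "C + D"], rule always_eventually, rule allI)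
  fix k
  have pos: "(1 + \<gamma> * h) ^ k > 0"
    using assms by (simp add: add_pos_nonneg)
  have "(1 + \<gamma> * h) ^ k \<le> exp (\<gamma> * h) ^ k"
    using assms by (intro power_mono) auto
  also have "\<dots> = exp (\<gamma> * (real k * h))"
    by (simp flip: exp_of_nat_mult add: mult_ac)
  finally have "exp (- \<gamma> * (real k * h)) \<le> 1 / (1 + \<gamma> * h) ^ k"
    using pos by (simp add: exp_minus field_simps)
  then have "C * exp (- \<gamma> * (real k * h)) \<le> C * (1 / (1 + \<gamma> * h) ^ k)"
    using assms by (intro mult_left_mono) auto
  then have "norm (X (real k * h) - z) \<le> C / (1 + \<gamma> * h) ^ k"
    using X[of "real k * h"] assms(1) by simp
  moreover have "norm (X (real k * h) - a k) \<le> norm (X (real k * h) - z) + norm (a k - z)"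
    by (metis norm_triangle_ineq4 diff_diff_eq2 diff_add_cancel)
  ultimately have "norm (X (real k * h) - a k) \<le> C / (1 + \<gamma> * h) ^ k + D / (1 + \<gamma> * h) ^ k"
    using a[of k] by linarith
  then show "norm (norm (X (real k * h) - a k)) \<le> (C + D) * norm ((1 + \<gamma> * h) powi (- int k))"
    using pos by (simp add: power_int_minus add_divide_distrib divide_inverse distrib_right)
qed

theorem lemma8:
  fixes f :: "real ^ 'd \<Rightarrow> real"
    and X V :: "real \<Rightarrow> real ^ 'd"
    and \<mu> L m n q s :: real
  assumes "\<mu> > 0"
    and "strongly_convex \<mu> f"
    and "L_smooth L f"
    and "s > 0"
    and "ode_solution m n q f X V"
  shows
    "(0 < m * sqrt s - n * s / (1 - q * sqrt s) \<and>
      m * sqrt s - n * s / (1 - q * sqrt s) \<le> 1 / (2 * L) \<and>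
      0 < n * s \<and> n * s \<le> (1 - q * sqrt s) / 2 * (m * sqrt s) \<and>
      0 < q * sqrt s \<and> q * sqrt s \<le> 1 / 2 \<longrightarrow>
      (\<forall>x v. explicit_euler m n q s f x v \<longrightarrow>
         (\<lambda>k::nat. norm (X (real k * sqrt s) - x k))
           \<in> O(\<lambda>k. (1 + gamma3 \<mu> L n q s * sqrt s) powi (- int k)))) \<and>
     (0 < m * sqrt s \<and> m * sqrt s \<le> 1 / (2 * L) \<and>
      0 < n * s \<and> n * s \<le> m * sqrt s \<and>
      0 < q * sqrt s \<and> q * sqrt s \<le> 1 / 2 \<longrightarrow>
      (\<forall>x v. semi_implicit_euler m n q s f x v \<longrightarrow>
         (\<lambda>k::nat. norm (X (real k * sqrt s) - x (Suc k)))
           \<in> O(\<lambda>k. (1 + gamma2 \<mu> L n q * sqrt s) powi (- int k))))"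
proof -
  obtain z where z: "grad f z = 0"
    using strongly_convex_stationary_point assms by blast
  have h: "sqrt s > 0" "sqrt s * sqrt s = s"
    using assms by auto
  have pos: "n > 0" "q > 0" if "0 < n * s" "0 < q * sqrt s"
    using that assms(4) by (auto simp: zero_less_mult_iff)
  \<comment> \<open>The second entry of the minimum in both rates is at most \<open>q\<close>, which
    yields \<open>5 * \<gamma> \<le> q\<close>.\<close>
  have damping: "q / (1 + q\<^sup>2 / (n * L)) \<le> q" "0 < q / (1 + q\<^sup>2 / (n * L))"
    if "0 < n" "0 < q" "0 < L"
  proof -
    define d where "d = 1 + q\<^sup>2 / (n * L)"
    have "1 \<le> d" using that by (simp add: d_def)
    then show "q / (1 + q\<^sup>2 / (n * L)) \<le> q" "0 < q / (1 + q\<^sup>2 / (n * L))"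
      unfolding d_def[symmetric] using that by (simp_all add: divide_le_eq)
  qed
  \<comment> \<open>The case \<open>L = 0\<close> is excluded because \<open>1 / (2 * L)\<close>
    would then be \<open>0\<close>.\<close>
  have L_pos: "L > 0" if "0 < c" "c \<le> 1 / (2 * L)" for c
    using that zero_less_divide_1_iff[of "2 * L"] by linarith
  show ?thesis
  proof (intro conjI impI allI; elim conjE)
    fix x v
    assume a: "0 < m * sqrt s - n * s / (1 - q * sqrt s)"
      "m * sqrt s - n * s / (1 - q * sqrt s) \<le> 1 / (2 * L)"
      and b: "0 < n * s" "n * s \<le> (1 - q * sqrt s) / 2 * (m * sqrt s)"
      and p: "0 < q * sqrt s" "q * sqrt s \<le> 1 / 2"
      and ee: "explicit_euler m n q s f x v"
    define \<gamma> where "\<gamma> = gamma3 \<mu> L n q s"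
    define r where "r = 1 - q * sqrt s"
    have r: "1 / 2 \<le> r" "r < 1" using p by (auto simp: r_def)
    note pos = pos[OF b(1) p(1)] and L = L_pos[OF a]
    note damping = damping[OF pos L]
    have \<gamma>: "0 \<le> \<gamma>" "5 * \<gamma> \<le> q" "5 * \<gamma> \<le> n * \<mu> / (q * r)"
    proof -
      have eq: "5 * \<gamma> = min (n * \<mu> / (q * r)) (q / (1 + q\<^sup>2 / (n * L)))"
        by (simp add: \<gamma>_def gamma3_def r_def)
      have "0 \<le> n * \<mu> / (q * r)"
        using pos r assms(1) by simp
      then have "0 \<le> 5 * \<gamma>"
        unfolding eq using damping(2) by simp
      then show "0 \<le> \<gamma>" by simp
      show "5 * \<gamma> \<le> q" "5 * \<gamma> \<le> n * \<mu> / (q * r)"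
        unfolding eq using damping(1) by (auto intro: min.coboundedI1 min.coboundedI2)
    qed
    then have \<gamma>q: "5 * \<gamma> * q \<le> n / r * \<mu>"
      using pos r by (simp add: field_simps)
    have m: "2 * n / r * sqrt s \<le> m"
    proof -
      have "(2 * n * sqrt s) * sqrt s = 2 * (n * s)"
        using h(2) by (simp only: mult.assoc)
      also have "\<dots> \<le> (r * m) * sqrt s"
        using b(2) by (simp add: r_def)
      finally have "2 * n * sqrt s \<le> r * m"
        using h(1) by (rule mult_right_le_imp_le)
      then show ?thesis
        using r by (simp add: field_simps)
    qed
    have "0 \<le> 2 * n / r * sqrt s"
      using pos h r by simp
    then have "0 \<le> m"
      using m by (rule order_trans)
    \<comment> \<open>The rate of the explicit scheme only gives a bound by
      \<open>n / r * \<mu>\<close>. As \<open>r + q * sqrt s = 1\<close>, the excess of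
      \<open>n / r\<close> over \<open>n\<close> is \<open>w\<close>, and the bound on the step size
      makes it at most \<open>m * q\<close>.\<close>
    moreover have "4 * \<gamma> * q \<le> (n + m * q) * \<mu>"
    proof -
      define w where "w = n / r * sqrt s * q"
      have "2 * w \<le> m * q"
        using mult_right_mono[OF m, of q] pos by (simp add: w_def)
      moreover have "n / r = n + w"
        using r by (simp add: w_def r_def field_simps)
      moreover have "0 \<le> w"
        using pos h r by (simp add: w_def)
      ultimately have "n / r \<le> n + m * q" by linarith
      then have "n / r * \<mu> \<le> (n + m * q) * \<mu>"
        using assms(1) by (intro mult_right_mono) auto
      moreover have "0 \<le> \<gamma> * q" using \<gamma> pos by simp
      ultimately show ?thesis using \<gamma>q by linarith
    qed
    ultimately obtain C where C: "C \<ge> 0" "\<And>t. t \<ge> 0 \<Longrightarrow> norm (X t - z) \<le> C * exp (- \<gamma> * t)"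
      using ode_solution_exponential_decay[OF assms(1,2,5) z, of \<gamma>] \<gamma> pos by auto
    have "(m - n * sqrt s / r) * sqrt s = m * sqrt s - n * s / r"
      using h by (simp add: algebra_simps)
    \<comment> \<open>With \<open>b = n / r * s\<close> and \<open>a = m * sqrt s - b\<close> as
      rescaled parameters, this is the condition \<open>b \<le> a\<close> of the semi-implicit
      scheme.\<close>
    moreover have "2 * (n / r * s) \<le> m * sqrt s"
      using b(2) r by (simp add: r_def[symmetric] field_simps)
    moreover have "0 < n / r * s" using b(1) r by simp
    moreover have "semi_implicit_euler (m - n * sqrt s / r) (n / r) q s f x (\<lambda>k. v (Suc k))"
      unfolding r_def using ee assms(4) p(2) by (intro explicit_euler_imp_semi_implicit_euler) auto
    ultimately obtain D where D: "D \<ge> 0" "\<And>k. norm (x k - z) \<le> D / (1 + \<gamma> * sqrt s) ^ k"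
      using semi_implicit_euler_linear_convergence[OF assms(1,2,3) z assms(4),
          of "m - n * sqrt s / r" "n / r" q \<gamma> x "\<lambda>k. v (Suc k)"] a p \<gamma> \<gamma>q
      by (auto simp: r_def[symmetric])
    show "(\<lambda>k. norm (X (real k * sqrt s) - x k))
        \<in> O(\<lambda>k. (1 + gamma3 \<mu> L n q s * sqrt s) powi (- int k))"
      unfolding \<gamma>_def[symmetric] by (rule bigo_geometric[OF h(1) \<gamma>(1) C(1) D(1) C(2) D(2)])
  next
    fix x v
    assume a: "0 < m * sqrt s" "m * sqrt s \<le> 1 / (2 * L)"
      and b: "0 < n * s" "n * s \<le> m * sqrt s"
      and p: "0 < q * sqrt s" "q * sqrt s \<le> 1 / 2"
      and sie: "semi_implicit_euler m n q s f x v"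
    define \<gamma> where "\<gamma> = gamma2 \<mu> L n q"
    note pos = pos[OF b(1) p(1)] and L = L_pos[OF a]
    note damping = damping[OF pos L]
    have m: "m > 0" using a h by (simp add: zero_less_mult_iff)
    have \<gamma>: "0 \<le> \<gamma>" "5 * \<gamma> \<le> q" "5 * \<gamma> \<le> n * \<mu> / q"
    proof -
      have eq: "5 * \<gamma> = min (n * \<mu> / q) (q / (1 + q\<^sup>2 / (n * L)))"
        by (simp add: \<gamma>_def gamma2_def)
      have "0 \<le> n * \<mu> / q"
        using pos assms(1) by simp
      then have "0 \<le> 5 * \<gamma>"
        unfolding eq using damping(2) by simp
      then show "0 \<le> \<gamma>" by simp
      show "5 * \<gamma> \<le> q" "5 * \<gamma> \<le> n * \<mu> / q"
        unfolding eq using damping(1) by (auto intro: min.coboundedI1 min.coboundedI2)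
    qed
    then have \<gamma>q: "5 * \<gamma> * q \<le> n * \<mu>"
      using pos by (simp add: field_simps)
    moreover have "0 \<le> \<gamma> * q" "0 \<le> m * q * \<mu>" using \<gamma> pos m assms(1) by simp_all
    ultimately have "4 * \<gamma> * q \<le> (n + m * q) * \<mu>"
      by (simp add: distrib_right)
    then obtain C where C: "C \<ge> 0" "\<And>t. t \<ge> 0 \<Longrightarrow> norm (X t - z) \<le> C * exp (- \<gamma> * t)"
      using ode_solution_exponential_decay[OF assms(1,2,5) z, of \<gamma>] \<gamma> pos m by auto
    obtain D where D: "D \<ge> 0" "\<And>k. norm (x k - z) \<le> D / (1 + \<gamma> * sqrt s) ^ k"
      using semi_implicit_euler_linear_convergence[OF assms(1,2,3) z assms(4) a(2) b p _ _ \<gamma>q sie] \<gamma>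
      by auto
    \<comment> \<open>The trajectory at step \<open>k\<close> is compared with iterate
      \<open>k + 1\<close>; the additional contraction factor is simply dropped.\<close>
    have D': "norm (x (Suc k) - z) \<le> D / (1 + \<gamma> * sqrt s) ^ k" for k
    proof -
      have "(1 + \<gamma> * sqrt s) ^ k \<le> (1 + \<gamma> * sqrt s) ^ Suc k"
        using \<gamma> h by (intro power_increasing) auto
      then have "D / (1 + \<gamma> * sqrt s) ^ Suc k \<le> D / (1 + \<gamma> * sqrt s) ^ k"
        using \<gamma> h D(1) by (intro divide_left_mono mult_pos_pos zero_less_power) (auto intro: add_pos_nonneg)
      then show ?thesis using D(2)[of "Suc k"] by linarith
    qed
    show "(\<lambda>k. norm (X (real k * sqrt s) - x (Suc k)))
        \<in> O(\<lambda>k. (1 + gamma2 \<mu> L n q * sqrt s) powi (- int k))"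
      unfolding \<gamma>_def[symmetric] by (rule bigo_geometric[OF h(1) \<gamma>(1) C(1) D(1) C(2) D'])
  qed
qed

end
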